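(* Let $F$ be a field of characteristic not $2$ and let $P(X)=X^4+uX^3+vX^2+wX+z\in F[X]$. Put $P_0=P(-\tfrac{u}{4})$, $P_1=P'(-\tfrac{u}{4})$, $P_2=P''(-\tfrac{u}{4})$, where $P',P''$ are the first and second derivatives of $P$. Then: \begin{enumerate} \item If $z=0$, then $P(X)$ is reducible with $0$ as a root. \item If $z\neq 0$ and $P_0=0$, then $P(X)$ is reducible with $-\tfrac{u}{4}$ as a root. \item If $z\neq 0$, $P_0\neq 0$ and $P_1=0$, then $P(X)$ is irreducible if and only if $S(X)=P(X-\tfrac{u}{4})=X^4+aX^2+b$ is irreducible, where $a=\tfrac12 P_2$ and $b=P_0$. \item If $z\neq 0$, $u\neq 0$, $P_0\neq 0$ and $P_1\neq 0$, then the following are equivalent: (a) $P(X)$ is irreducible over $F$; (b) $R(X)=X^4+aX^2+bX+b$ is irreducible over $F$, where $a=\frac{P_1^2P_2}{2P_0^2}$ and $b=\frac{P_1^4}{P_0^3}$; (c) $T(X)=X^4+X^3+cX^2+d$ is irreducible over $F$, where $c=\frac{P_2P_0}{2P_1^2}$ and $d=\frac{P_0^3}{P_1^4}$. \end{enumerate}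
   Context: $F$ is a field of characteristic different from $2$. *)

theory Defs
  imports "HOL-Computational_Algebra.Computational_Algebra"
begin

end

theory Submission
  imports Defs
begin

text \<open>
  The Taylor expansion of \<open>P\<close> at \<open>- u / 4\<close> has no cubic term:
  \<open>P(X - u/4) = X^4 + (P2/2) X^2 + P1 X + P0\<close>. Substituting \<open>(P0/P1) X\<close> for \<open>X\<close> and making the
  result monic gives \<open>R\<close>, and the monic reciprocal polynomial of \<open>R\<close> is \<open>T\<close>. Affine substitutions,
  nonzero scalars and reciprocals (when the constant term is nonzero) all preserve irreducibility.
\<close>

lemma pcompose_linear_inverse:
  fixes p :: "'a :: field poly"
  assumes "b \<noteq> 0"
  shows "pcompose (pcompose p [:a, b:]) [:- (a / b), 1 / b:] = p"
  using assms by (simp add: pcompose_assoc [symmetric] pcompose_pCons)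

text \<open>Composition with a nonconstant linear polynomial is multiplicative and preserves
  degrees. A factorization of \<open>p\<close> therefore carries over, and units correspond because
  over a field they are the nonzero constants.\<close>

lemma irreducible_of_pcompose_linear:
  fixes p :: "'a :: field poly"
  assumes b: "b \<noteq> 0" and irr: "irreducible (pcompose p [:a, b:])"
  shows "irreducible p"
proof (rule irreducibleI)
  show "p \<noteq> 0"
    using irr by auto
  then show "\<not> p dvd 1"
    using irr b by (auto simp: irreducible_def is_unit_iff_degree pcompose_eq_0_iff degree_pcompose)
next
  fix r s assume p: "p = r * s"
  have nz: "p \<noteq> 0"
    using irr by auto
  have "pcompose r [:a, b:] dvd 1 \<or> pcompose s [:a, b:] dvd 1"
    using irr by (intro irreducibleD [OF irr]) (simp add: p pcompose_mult)
  then show "r dvd 1 \<or> s dvd 1"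
    using nz b p by (auto simp: is_unit_iff_degree pcompose_eq_0_iff degree_pcompose)
qed

text \<open>The converse direction is the previous lemma applied to the inverse substitution, which
  is again linear.\<close>

lemma irreducible_pcompose_linear_iff:
  fixes p :: "'a :: field poly"
  assumes "b \<noteq> 0"
  shows "irreducible (pcompose p [:a, b:]) \<longleftrightarrow> irreducible p"
  using assms irreducible_of_pcompose_linear [of b p a]
    irreducible_of_pcompose_linear [of "1 / b" "pcompose p [:a, b:]" "- (a / b)"]
  by (auto simp: pcompose_linear_inverse)

lemma irreducible_smult_iff:
  fixes p :: "'a :: field poly"
  assumes "c \<noteq> 0"
  shows "irreducible (smult c p) \<longleftrightarrow> irreducible p"
proof -
  have "is_unit [:c:]"
    using assms by (simp add: is_unit_iff_degree)
  then show ?thesis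
    using irreducible_mult_unit_left [of "[:c:]" p] by simp
qed

text \<open>Reflection is multiplicative, but it preserves the degree only when the constant term is
  nonzero. This condition passes from a product to its factors.\<close>

lemma irreducible_of_reflect_poly:
  fixes p :: "'a :: field poly"
  assumes c: "coeff p 0 \<noteq> 0" and irr: "irreducible (reflect_poly p)"
  shows "irreducible p"
proof (rule irreducibleI)
  show "p \<noteq> 0"
    using c by auto
  then show "\<not> p dvd 1"
    using irr c by (auto simp: irreducible_def is_unit_iff_degree)
next
  fix r s assume p: "p = r * s"
  then have "coeff r 0 \<noteq> 0" "coeff s 0 \<noteq> 0"
    using c by (auto simp: coeff_mult)
  moreover have "reflect_poly r dvd 1 \<or> reflect_poly s dvd 1"
    by (intro irreducibleD [OF irr]) (simp add: p reflect_poly_mult)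
  moreover have "r \<noteq> 0" "s \<noteq> 0"
    using c p by auto
  ultimately show "r dvd 1 \<or> s dvd 1"
    by (auto simp: is_unit_iff_degree)
qed

text \<open>With nonzero constant term, reflecting twice gives \<open>p\<close> back. The reflected
  polynomial also has nonzero constant term, namely the leading coefficient of
  \<open>p\<close>.\<close>

lemma irreducible_reflect_poly_iff:
  fixes p :: "'a :: field poly"
  assumes "coeff p 0 \<noteq> 0"
  shows "irreducible (reflect_poly p) \<longleftrightarrow> irreducible p"
proof -
  have "coeff (reflect_poly p) 0 \<noteq> 0"
    using assms by auto
  then show ?thesis
    using assms irreducible_of_reflect_poly [of p] irreducible_of_reflect_poly [of "reflect_poly p"]
    by (auto simp: reflect_poly_reflect_poly)
qed

text \<open>The root splits off a linear factor; degree above 1 leaves a nonconstant cofactor, so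
  neither factor is a unit.\<close>

lemma reducible_of_root:
  fixes p :: "'a :: field poly"
  assumes "degree p > 1" "poly p x = 0"
  shows "\<not> irreducible p"
proof
  assume irr: "irreducible p"
  obtain q where q: "p = [:- x, 1:] * q"
    using assms(2) by (auto simp: poly_eq_0_iff_dvd)
  then have "q \<noteq> 0"
    using assms(1) by auto
  then have "degree p = degree q + 1"
    using degree_mult_eq [of "[:- x, 1:]" q] by (simp only: q) simp
  then have "\<not> q dvd 1" "\<not> [:- x, 1:] dvd 1"
    using assms(1) \<open>q \<noteq> 0\<close> by (simp_all add: is_unit_iff_degree)
  then show False
    using irreducibleD [OF irr q] by blast
qed

lemma two_neq_zero_of_CHAR_neq_2:
  assumes "CHAR('a :: idom) \<noteq> 2"
  shows "(2 :: 'a) \<noteq> 0"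
proof
  assume "(2 :: 'a) = 0"
  then have "CHAR('a) dvd 2"
    using of_nat_eq_0_iff_char_dvd [where 'a = 'a, of 2] by simp
  \<comment> \<open>The divisors of the prime 2 are 1 and 2; characteristic 1 would force 1 =
    0.\<close>
  then have "CHAR('a) = 1"
    using assms by (metis prime_nat_iff two_is_prime_nat)
  then show False
    using CHAR_not_1' [where 'a = 'a] by simp
qed

lemma depressed_quartic:
  fixes u v w z :: "'a :: field"
  assumes two: "(2 :: 'a) \<noteq> 0" and P: "P = [:z, w, v, u, 1:]"
  shows "pcompose P [:- u / 4, 1:] =
    [:poly P (- u / 4), poly (pderiv P) (- u / 4), poly (pderiv (pderiv P)) (- u / 4) / 2, 0, 1:]"
proof -
  have "(4 :: 'a) = 2 * 2"
    by simp
  then have four: "(4 :: 'a) \<noteq> 0"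
    using two by (metis mult_eq_0_iff)
  define t where "t = - u / 4"
  \<comment> \<open>Eliminating \<open>u\<close> in favour of \<open>t\<close> makes the cubic
    coefficient \<open>u + 4 * t\<close> vanish identically and leaves 2 as the only
    denominator.\<close>
  have u: "u = - (4 * t)"
    using four by (simp add: t_def)
  show ?thesis
    unfolding t_def [symmetric] P u using two
    by (simp add: pcompose_pCons pderiv_pCons field_simps)
qed

theorem lemma2p1:
  fixes u v w z P0 P1 P2 :: "'a :: field" and P :: "'a poly"
  assumes char: "CHAR('a) \<noteq> 2"
    and P: "P = [:z, w, v, u, 1:]"
    and P0: "P0 = poly P (- u / 4)"
    and P1: "P1 = poly (pderiv P) (- u / 4)"
    and P2: "P2 = poly (pderiv (pderiv P)) (- u / 4)"
  shows
    "(z = 0 \<longrightarrow> \<not> irreducible P \<and> poly P 0 = 0) \<and>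
     (z \<noteq> 0 \<and> P0 = 0 \<longrightarrow> \<not> irreducible P \<and> poly P (- u / 4) = 0) \<and>
     (z \<noteq> 0 \<and> P0 \<noteq> 0 \<and> P1 = 0 \<longrightarrow>
        (let a = P2 / 2; b = P0; S = pcompose P [:- u / 4, 1:] in
           S = [:b, 0, a, 0, 1:] \<and> (irreducible P \<longleftrightarrow> irreducible S))) \<and>
     (z \<noteq> 0 \<and> u \<noteq> 0 \<and> P0 \<noteq> 0 \<and> P1 \<noteq> 0 \<longrightarrow>
        (let a = P1 ^ 2 * P2 / (2 * P0 ^ 2); b = P1 ^ 4 / P0 ^ 3; R = [:b, b, a, 0, 1:];
             c = P2 * P0 / (2 * P1 ^ 2); d = P0 ^ 3 / P1 ^ 4; T = [:d, 0, c, 1, 1:] in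
           (irreducible P \<longleftrightarrow> irreducible R) \<and> (irreducible R \<longleftrightarrow> irreducible T)))"
proof -
  have two: "(2 :: 'a) \<noteq> 0"
    using char by (rule two_neq_zero_of_CHAR_neq_2)
  define S where "S = pcompose P [:- u / 4, 1:]"
  have S: "S = [:P0, P1, P2 / 2, 0, 1:]"
    unfolding S_def P0 P1 P2 using two P by (rule depressed_quartic)
  have PS: "irreducible P \<longleftrightarrow> irreducible S"
    unfolding S_def by (simp add: irreducible_pcompose_linear_iff)
  have root: "\<not> irreducible P" if "poly P x = 0" for x
    using that by (intro reducible_of_root) (simp_all add: P)
  have quartic: "(irreducible P \<longleftrightarrow> irreducible R) \<and> (irreducible R \<longleftrightarrow> irreducible T)"
    if nz: "P0 \<noteq> 0" "P1 \<noteq> 0"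
      and R: "R = [:P1 ^ 4 / P0 ^ 3, P1 ^ 4 / P0 ^ 3, P1 ^ 2 * P2 / (2 * P0 ^ 2), 0, 1:]"
      and T: "T = [:P0 ^ 3 / P1 ^ 4, 0, P2 * P0 / (2 * P1 ^ 2), 1, 1:]" for R T
  proof
    \<comment> \<open>The scale \<open>P0 / P1\<close> is chosen to make the linear and constant
      coefficients agree: after normalization both are \<open>P1 ^ 4 / P0 ^ 3\<close>.\<close>
    have "smult ((P1 / P0) ^ 4) (pcompose S [:0, P0 / P1:]) = R"
      using nz two by (simp add: S R pcompose_pCons field_simps power_numeral_reduce)
    then show "irreducible P \<longleftrightarrow> irreducible R"
      using nz PS irreducible_smult_iff [of "(P1 / P0) ^ 4" "pcompose S [:0, P0 / P1:]"]
        irreducible_pcompose_linear_iff [of "P0 / P1" S 0] by simp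
    \<comment> \<open>Reflection turns these two equal coefficients into those of X^4 and X^3, so
      dividing by their common value makes both 1.\<close>
    have "smult (P0 ^ 3 / P1 ^ 4) (reflect_poly R) = T"
      using nz two by (simp add: R T reflect_poly_def field_simps power_numeral_reduce)
    then show "irreducible R \<longleftrightarrow> irreducible T"
      using nz irreducible_smult_iff [of "P0 ^ 3 / P1 ^ 4" "reflect_poly R"]
        irreducible_reflect_poly_iff [of R] by (simp add: R)
  qed
  have "z = 0 \<Longrightarrow> poly P 0 = 0"
    by (simp add: P)
  then show ?thesis
    \<comment> \<open>The third case is the formula for \<open>S\<close> with \<open>P1 = 0\<close>
      together with \<open>PS\<close>.\<close>
    unfolding Let_def S_def [symmetric]
    using root [of 0] root [of "- u / 4"] P0 S PS quartic by simp
qed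

end
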